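(* For all compositions $\alpha,\beta$ of $n$ and $N\ge n$, the coefficient of $G_\beta(x_1,\ldots,x_N;t)$ in the expansion of $F_\alpha(x_1,\ldots,x_N)$ in the basis $\{G_\gamma\}_{\gamma}$ is $t^{g(\alpha,\beta)}$ if $\beta\succeq\alpha$ and $0$ otherwise; that is, $F_\alpha=\sum_{\beta\succeq\alpha}t^{g(\alpha,\beta)}G_\beta$.
   Context: For a composition $\alpha=(\alpha_1,\ldots,\alpha_k)$ of $n$, $\ell(\alpha)=k$ and $\mathrm{sub}(\alpha)=\{\alpha_1,\alpha_1+\alpha_2,\ldots,\alpha_1+\cdots+\alpha_{k-1}\}\subseteq[n-1]$. Write $\beta\succeq\alpha$ ($\beta$ finer than $\alpha$) iff $\mathrm{sub}(\alpha)\subseteq\mathrm{sub}(\beta)$. If $\beta\succeq\alpha$ with $\ell(\beta)=m$, there are indices $0=i_0<i_1<\dots<i_k=m$ with $\alpha_j=\beta_{i_{j-1}+1}+\dots+\beta_{i_j}$; set $s(\alpha,\beta)=\sum_{j=1}^k j(i_j-i_{j-1}-1)$. For $1\le j\le \ell(\beta)-1$ let $\xi_{\alpha,\beta}(j)=j$ if $\beta_j$ and $\beta_{j+1}$ are formed from the same part of $\alpha$ (i.e. $\beta_1+\dots+\beta_j\notin\mathrm{sub}(\alpha)$) and $0$ otherwise; $g(\alpha,\beta)=\sum_{j=1}^{\ell(\beta)-1}\xi_{\alpha,\beta}(j)$. $F_\alpha(x_1,\ldots,x_N)=\sum x_{w_1}\cdots x_{w_n}$ over $1\le w_1\le\dots\le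 w_n\le N$ with $w_j<w_{j+1}$ for $j\in\mathrm{sub}(\alpha)$ (Gessel's fundamental quasisymmetric polynomials, a basis of degree-$n$ quasisymmetric polynomials for $N\ge n$). Hivert's quasisymmetric Hall–Littlewood polynomials satisfy (and may be taken to be defined by) $G_\alpha(x_1,\ldots,x_N;t)=\sum_{\beta\succeq\alpha}(-1)^{\ell(\beta)-\ell(\alpha)}t^{s(\alpha,\beta)}F_\beta(x_1,\ldots,x_N)$. *)

theory Defs
  imports Complex_Main "HOL-Library.Poly_Mapping"
begin

section \<open>Compositions\<close>

definition compositions :: "nat \<Rightarrow> nat list set" where
  "compositions n = {\<alpha>. (\<forall>a\<in>set \<alpha>. 0 < a) \<and> sum_list \<alpha> = n}"

definition sub :: "nat list \<Rightarrow> nat set" where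
  "sub \<alpha> = {sum_list (take i \<alpha>) | i. 1 \<le> i \<and> i < length \<alpha>}"

text \<open>\<open>finer \<beta> \<alpha>\<close> is only meaningful for compositions of the same \<open>n\<close>.\<close>

definition finer :: "nat list \<Rightarrow> nat list \<Rightarrow> bool" where
  "finer \<beta> \<alpha> \<longleftrightarrow> sub \<alpha> \<subseteq> sub \<beta>"

text \<open>
  \<open>i\<close> lists the cut points \<open>0 = i 0 < \<dots> < i (length \<alpha>) = length \<beta>\<close>.
  Lists are indexed from 0, so the parts of \<open>\<beta>\<close> numbered from \<open>i j + 1\<close> to \<open>i (j + 1)\<close>
  are the entries \<open>\<beta> ! r\<close> with \<open>i j \<le> r < i (j + 1)\<close>.
\<close>

definition cut_indices :: "nat list \<Rightarrow> nat list \<Rightarrow> (nat \<Rightarrow> nat) \<Rightarrow> bool" where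
  "cut_indices \<alpha> \<beta> i \<longleftrightarrow> i 0 = 0 \<and> i (length \<alpha>) = length \<beta> \<and>
     (\<forall>j<length \<alpha>. i j < i (Suc j) \<and> \<alpha> ! j = (\<Sum>r = i j..<i (Suc j). \<beta> ! r))"

text \<open>
  When \<open>\<beta>\<close> is finer than \<open>\<alpha>\<close>, cut points exist and are unique on \<open>{0..length \<alpha>}\<close>; only these
  values enter \<open>s_exp\<close>, and the truncated subtraction is the subtraction of integers.
\<close>

definition s_exp :: "nat list \<Rightarrow> nat list \<Rightarrow> nat" where
  "s_exp \<alpha> \<beta> = (let i = (SOME i. cut_indices \<alpha> \<beta> i)
     in \<Sum>j = 1..length \<alpha>. j * (i j - i (j - 1) - 1))"

definition \<xi> :: "nat list \<Rightarrow> nat list \<Rightarrow> nat \<Rightarrow> nat" where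
  "\<xi> \<alpha> \<beta> j = (if sum_list (take j \<beta>) \<notin> sub \<alpha> then j else 0)"

definition g_exp :: "nat list \<Rightarrow> nat list \<Rightarrow> nat" where
  "g_exp \<alpha> \<beta> = (\<Sum>j = 1..<length \<beta>. \<xi> \<alpha> \<beta> j)"


section \<open>Quasisymmetric polynomials\<close>

text \<open>
  Polynomials over \<open>'a\<close> in variables indexed by natural numbers; a polynomial in
  \<open>x\<^sub>1, \<dots>, x\<^sub>N\<close> is one that involves only these variables.
\<close>

type_synonym 'a polynomials = "(nat \<Rightarrow>\<^sub>0 nat) \<Rightarrow>\<^sub>0 'a"

definition var :: "nat \<Rightarrow> 'a::comm_ring_1 polynomials" where
  "var i = Poly_Mapping.single (Poly_Mapping.single i 1) 1"

definition scale :: "'a::comm_ring_1 \<Rightarrow> 'a polynomials \<Rightarrow> 'a polynomials" where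
  "scale c p = Poly_Mapping.single 0 c * p"

global_interpretation polys: module scale
  by unfold_locales
    (simp_all add: scale_def distrib_left distrib_right single_add
      mult_single flip: mult.assoc)

definition words :: "nat \<Rightarrow> nat list \<Rightarrow> nat list set" where
  "words N \<alpha> = {w. length w = sum_list \<alpha> \<and> set w \<subseteq> {1..N} \<and> sorted w \<and>
     (\<forall>j\<in>sub \<alpha>. w ! (j - 1) < w ! j)}"

definition F :: "nat \<Rightarrow> nat list \<Rightarrow> 'a::comm_ring_1 polynomials" where
  "F N \<alpha> = (\<Sum>w\<in>words N \<alpha>. prod_list (map var w))"

text \<open>
  The parameter \<open>t\<close> is an arbitrary element of the coefficient ring; the case of an indeterminate
  is that of a coefficient ring such as \<open>\<int>[t]\<close> or \<open>\<rat>(t)\<close>.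
\<close>

definition G :: "'a::comm_ring_1 \<Rightarrow> nat \<Rightarrow> nat list \<Rightarrow> 'a polynomials" where
  "G t N \<alpha> = (\<Sum>\<beta> | \<beta> \<in> compositions (sum_list \<alpha>) \<and> finer \<beta> \<alpha>.
     scale ((-1) ^ (length \<beta> - length \<alpha>) * t ^ s_exp \<alpha> \<beta>) (F N \<beta>))"

end

theory Submission
  imports Defs "HOL-Library.Multiset"
begin

text \<open>
  A composition \<open>\<gamma>\<close> of \<open>n\<close> is the same thing as the set \<open>C = sub \<gamma> \<subseteq> {1..<n}\<close>. In terms of sets,
  both \<open>s\<close> and \<open>g\<close> count strictly smaller elements:
  \<open>s(A, B) = (\<Sum>d\<in>B - A. 1 + #{a \<in> A. a < d})\<close> and \<open>g(A, B) = (\<Sum>d\<in>B - A. 1 + #{b \<in> B. b < d})\<close>.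
  Hence \<open>g(A, C) + s(C, B) = (\<Sum>d\<in>B - A. 1 + #{c \<in> C. c < d})\<close> whenever \<open>A \<subseteq> C \<subseteq> B\<close>. This does not
  change when the largest element of \<open>B - A\<close> is added to or removed from \<open>C\<close>, so the
  transition matrices are inverse to each other by a sign-reversing involution.

  The \<open>G\<^sub>\<gamma>\<close> are independent since they are unitriangular with respect to the coefficients of the
  monomials of the weakly increasing words whose set of ascents is exactly \<open>C\<close>.
\<close>

section \<open>Compositions as sets\<close>

abbreviation psum :: "nat list \<Rightarrow> nat \<Rightarrow> nat" where
  "psum \<alpha> i \<equiv> sum_list (take i \<alpha>)"

lemma sub_eq_image: "sub \<alpha> = psum \<alpha> ` {1..<length \<alpha>}"
  by (auto simp: sub_def)

lemma finite_sub: "finite (sub \<alpha>)"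
  by (simp add: sub_eq_image)

lemma psum_Suc: "i < length \<alpha> \<Longrightarrow> psum \<alpha> (Suc i) = psum \<alpha> i + \<alpha> ! i"
  by (simp add: take_Suc_conv_app_nth)

lemma psum_eq_sum: "i \<le> length \<alpha> \<Longrightarrow> psum \<alpha> i = (\<Sum>r = 0..<i. \<alpha> ! r)"
  by (simp add: sum_list_sum_nth)

lemma psum_strict_mono_on:
  assumes "\<alpha> \<in> compositions n"
  shows "strict_mono_on {..length \<alpha>} (psum \<alpha>)"
proof (rule strict_mono_onI)
  fix i j assume "i \<in> {..length \<alpha>}" "j \<in> {..length \<alpha>}" "i < j"
  then show "psum \<alpha> i < psum \<alpha> j"
  proof (induction j)
    case (Suc j)
    then have "psum \<alpha> j < psum \<alpha> (Suc j)"
      using assms by (simp add: psum_Suc compositions_def)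
    moreover have "psum \<alpha> i \<le> psum \<alpha> j"
      using Suc by (cases "i = j") auto
    ultimately show ?case by simp
  qed simp
qed

lemma psum_less_iff:
  assumes "\<alpha> \<in> compositions n" "i \<le> length \<alpha>" "j \<le> length \<alpha>"
  shows "psum \<alpha> i < psum \<alpha> j \<longleftrightarrow> i < j"
  using strict_mono_on_less[OF psum_strict_mono_on[OF assms(1)]] assms by auto

lemma inj_on_psum:
  assumes "\<alpha> \<in> compositions n"
  shows "inj_on (psum \<alpha>) {..length \<alpha>}"
  using strict_mono_on_imp_inj_on[OF psum_strict_mono_on[OF assms]] .

lemma sub_subset:
  assumes "\<alpha> \<in> compositions n"
  shows "sub \<alpha> \<subseteq> {1..<n}"
proof
  fix x assume "x \<in> sub \<alpha>"
  then obtain i where i: "1 \<le> i" "i < length \<alpha>" "x = psum \<alpha> i" by (auto simp: sub_def)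
  have "psum \<alpha> 0 < psum \<alpha> i" "psum \<alpha> i < psum \<alpha> (length \<alpha>)"
    using i by (simp_all only: psum_less_iff[OF assms])
  then show "x \<in> {1..<n}" using i assms by (auto simp: compositions_def)
qed

lemma card_sub:
  assumes "\<alpha> \<in> compositions n"
  shows "card (sub \<alpha>) = length \<alpha> - 1"
proof -
  have "inj_on (psum \<alpha>) {1..<length \<alpha>}"
    by (rule inj_on_subset[OF inj_on_psum[OF assms]]) auto
  then show ?thesis by (simp add: sub_eq_image card_image)
qed

text \<open>Truncated subtraction makes this hold for the empty composition, too.\<close>

lemma length_diff_eq_card:
  assumes "\<alpha> \<in> compositions n" "\<beta> \<in> compositions n" "sub \<alpha> \<subseteq> sub \<beta>"
  shows "length \<beta> - length \<alpha> = card (sub \<beta> - sub \<alpha>)"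
proof -
  have "\<alpha> = [] \<longleftrightarrow> \<beta> = []"
    using assms(1,2) by (cases \<alpha>; cases \<beta>) (auto simp: compositions_def)
  then show ?thesis
    using card_Diff_subset[OF finite_sub assms(3)] card_sub[OF assms(1)] card_sub[OF assms(2)]
    by (cases "\<alpha> = []") (auto simp: Suc_le_eq)
qed

text \<open>Partial sums increase strictly, so those of index 1 to \<open>r - 1\<close> are the
  elements of \<open>sub \<alpha>\<close> below \<open>x\<close>. This recovers the number of the
  part containing \<open>x\<close> from the set alone and is how the weights in \<open>g_exp\<close>
  and \<open>s_exp\<close> become counts.\<close>

lemma card_sub_less:
  assumes "\<alpha> \<in> compositions n" "1 \<le> r" "r \<le> length \<alpha>"
    and "psum \<alpha> (r - 1) < x" "x \<le> psum \<alpha> r"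
  shows "Suc (card {a \<in> sub \<alpha>. a < x}) = r"
proof -
  have "{a \<in> sub \<alpha>. a < x} = psum \<alpha> ` {1..<r}"
  proof -
    have "psum \<alpha> q < x \<longleftrightarrow> q < r" if "q < length \<alpha>" for q
    proof
      assume "psum \<alpha> q < x"
      then have "psum \<alpha> q < psum \<alpha> r" using assms by linarith
      then show "q < r" using that assms psum_less_iff[OF assms(1)] by auto
    next
      assume "q < r"
      then have "\<not> psum \<alpha> (r - 1) < psum \<alpha> q"
        using that assms psum_less_iff[OF assms(1)] by auto
      then show "psum \<alpha> q < x" using assms by linarith
    qed
    then show ?thesis using assms(3) by (auto simp: sub_eq_image)
  qed
  moreover have "inj_on (psum \<alpha>) {1..<r}"
    by (rule inj_on_subset[OF inj_on_psum[OF assms(1)]]) (use assms in auto)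
  ultimately show ?thesis using assms by (simp add: card_image)
qed

section \<open>Bijection between compositions and subsets, by removing the last part\<close>

lemma sub_snoc: "sub (\<alpha> @ [k]) = (if \<alpha> = [] then {} else insert (sum_list \<alpha>) (sub \<alpha>))"
proof -
  have "{1..<Suc (length \<alpha>)} = (if \<alpha> = [] then {} else insert (length \<alpha>) {1..<length \<alpha>})"
    by (auto simp: Suc_le_eq)
  then show ?thesis by (auto simp: sub_eq_image)
qed

lemma snoc_in_compositions_iff:
  "\<alpha> @ [k] \<in> compositions n \<longleftrightarrow> \<alpha> \<in> compositions (n - k) \<and> 0 < k \<and> k \<le> n"
  by (auto simp: compositions_def)

lemma inj_on_sub: "inj_on sub (compositions n)"
proof (rule inj_onI)
  fix \<alpha> \<beta> assume "\<alpha> \<in> compositions n" "\<beta> \<in> compositions n" "sub \<alpha> = sub \<beta>"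
  then show "\<alpha> = \<beta>"
  proof (induction \<alpha> arbitrary: \<beta> n rule: rev_induct)
    case Nil
    then show ?case by (cases \<beta>) (auto simp: compositions_def)
  next
    case (snoc a \<alpha>)
    obtain b \<gamma> where \<beta>: "\<beta> = \<gamma> @ [b]"
      using snoc.prems by (cases \<beta> rule: rev_cases) (auto simp: compositions_def)
    have c: "\<alpha> \<in> compositions (n - a)" "\<gamma> \<in> compositions (n - b)" "a \<le> n" "b \<le> n"
      using snoc.prems by (auto simp: \<beta> snoc_in_compositions_iff)
    then have sums: "sum_list \<alpha> = n - a" "sum_list \<gamma> = n - b" by (auto simp: compositions_def)
    show ?case
    proof (cases "\<alpha> = [] \<or> \<gamma> = []")
      case True
      then show ?thesis using snoc.prems(3) sums c by (auto simp: \<beta> sub_snoc split: if_splits)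
    next
      case False
      then have eq: "insert (n - a) (sub \<alpha>) = insert (n - b) (sub \<gamma>)"
        using snoc.prems(3) sums by (auto simp: \<beta> sub_snoc)
      have s: "sub \<alpha> \<subseteq> {1..<n - a}" "sub \<gamma> \<subseteq> {1..<n - b}"
        using c sub_subset by auto
      \<comment> \<open>Both numbers are the maximum of the same set \<open>eq\<close>: the elements
        of \<open>sub \<alpha>\<close> lie below \<open>n - a\<close>, those of
        \<open>sub \<gamma>\<close> below \<open>n - b\<close>.\<close>
      have "n - a = n - b"
      proof (rule antisym)
        have "n - a \<in> insert (n - b) (sub \<gamma>)" using eq by blast
        then show "n - a \<le> n - b" using s by auto
        have "n - b \<in> insert (n - a) (sub \<alpha>)" using eq by blast
        then show "n - b \<le> n - a" using s by auto
      qed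
      moreover from this have "n - a \<notin> sub \<alpha>" "n - a \<notin> sub \<gamma>" using s by auto
      ultimately have "a = b" and "sub \<alpha> = sub \<gamma>"
        using eq c by (simp_all add: insert_ident)
      then show ?thesis using snoc.IH[of "n - a" \<gamma>] c \<beta> by auto
    qed
  qed
qed

text \<open>The largest element \<open>m\<close> of \<open>A\<close> marks where the last part
  \<open>n - m\<close> starts; by strong induction the other elements are the cut points of a
  composition of \<open>m\<close>.\<close>

lemma Pow_subset_image_sub:
  assumes "A \<subseteq> {1..<n}"
  shows "A \<in> sub ` compositions n"
  using assms
proof (induction n arbitrary: A rule: less_induct)
  case (less n)
  show ?case
  proof (cases "A = {}")
    case True
    \<comment> \<open>For \<open>n = 0\<close> the list \<open>[n]\<close> has a zero part, so the
      witness is the empty composition.\<close>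
    then have "A = sub (if n = 0 then [] else [n])" by (auto simp: sub_def)
    then show ?thesis by (rule image_eqI) (auto simp: compositions_def)
  next
    case False
    have fin: "finite A" using less.prems finite_subset by blast
    define m where "m = Max A"
    have m: "m \<in> A" and le: "\<And>a. a \<in> A \<Longrightarrow> a \<le> m"
      using False fin by (auto simp: m_def)
    have mn: "1 \<le> m" "m < n" using m less.prems by auto
    have "A - {m} \<subseteq> {1..<m}" using less.prems le by force
    then obtain \<gamma> where \<gamma>: "\<gamma> \<in> compositions m" "A - {m} = sub \<gamma>"
      using less.IH[of m] mn by blast
    then have "sum_list \<gamma> = m" "\<gamma> \<noteq> []" using mn by (auto simp: compositions_def)
    then have "A = sub (\<gamma> @ [n - m])" using \<gamma> m by (auto simp: sub_snoc)
    moreover have "\<gamma> @ [n - m] \<in> compositions n"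
      using mn \<gamma> by (simp add: snoc_in_compositions_iff)
    ultimately show ?thesis by blast
  qed
qed

lemma bij_betw_sub: "bij_betw sub (compositions n) (Pow {1..<n})"
  unfolding bij_betw_def
  using inj_on_sub sub_subset Pow_subset_image_sub by blast

lemma finite_compositions: "finite (compositions n)"
  using bij_betw_finite[OF bij_betw_sub] by simp

section \<open>The exponents\<close>

lemma g_exp_eq:
  assumes "\<beta> \<in> compositions n"
  shows "g_exp \<alpha> \<beta> = (\<Sum>d\<in>sub \<beta> - sub \<alpha>. Suc (card {b \<in> sub \<beta>. b < d}))"
proof -
  let ?R = "{r \<in> {1..<length \<beta>}. psum \<beta> r \<notin> sub \<alpha>}"
  have "g_exp \<alpha> \<beta> = (\<Sum>r\<in>?R. r)"
    unfolding g_exp_def \<xi>_def by (rule sum.inter_filter[symmetric]) simp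
  \<comment> \<open>The weight \<open>r\<close> is one more than the number of elements of
    \<open>sub \<beta>\<close> below the \<open>r\<close>-th partial sum;
    \<open>card_sub_less\<close> is used at the right end of its interval.\<close>
  also have "\<dots> = (\<Sum>r\<in>?R. Suc (card {b \<in> sub \<beta>. b < psum \<beta> r}))"
    by (rule sum.cong[OF refl], subst card_sub_less[OF assms])
      (auto simp: psum_less_iff[OF assms])
  also have "\<dots> = (\<Sum>d\<in>psum \<beta> ` ?R. Suc (card {b \<in> sub \<beta>. b < d}))"
    by (rule sum.reindex_cong[symmetric, OF _ refl refl])
      (auto intro: inj_on_subset[OF inj_on_psum[OF assms]])
  also have "psum \<beta> ` ?R = sub \<beta> - sub \<alpha>"
    by (auto simp: sub_eq_image)
  finally show ?thesis .
qed

section \<open>Cut points and the exponent s\<close>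

text \<open>Every partial sum of \<open>\<alpha>\<close>, including 0 and \<open>n\<close>, is also
  a partial sum of \<open>\<beta>\<close>; the cut point \<open>i j\<close> is the index at which
  \<open>\<beta>\<close> attains the \<open>j\<close>-th one. This makes the choice in
  \<open>s_exp\<close> meaningful.\<close>

lemma cut_indices_ex:
  assumes "\<alpha> \<in> compositions n" "\<beta> \<in> compositions n" "sub \<alpha> \<subseteq> sub \<beta>"
  shows "\<exists>i. cut_indices \<alpha> \<beta> i"
proof -
  have "\<exists>r. r \<le> length \<beta> \<and> psum \<beta> r = psum \<alpha> j" if "j \<le> length \<alpha>" for j
  proof -
    consider "j = 0" | "j = length \<alpha>" | "psum \<alpha> j \<in> sub \<alpha>"
      using \<open>j \<le> length \<alpha>\<close> by (cases "j = 0"; cases "j = length \<alpha>") (auto simp: sub_eq_image)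
    then show ?thesis
    proof cases
      case 1 then show ?thesis by (intro exI[of _ 0]) simp
    next
      case 2 then show ?thesis using assms(1,2)
        by (intro exI[of _ "length \<beta>"]) (auto simp: compositions_def)
    next
      case 3
      then have "psum \<alpha> j \<in> psum \<beta> ` {1..<length \<beta>}" using assms(3) sub_eq_image by blast
      then obtain r where "r < length \<beta>" "psum \<beta> r = psum \<alpha> j" by auto
      then show ?thesis by (intro exI[of _ r]) simp
    qed
  qed
  then have "\<forall>j\<in>{..length \<alpha>}. \<exists>r. r \<le> length \<beta> \<and> psum \<beta> r = psum \<alpha> j" by blast
  from bchoice[OF this] obtain i
    where i: "\<And>j. j \<le> length \<alpha> \<Longrightarrow> i j \<le> length \<beta> \<and> psum \<beta> (i j) = psum \<alpha> j"
    by blast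
  have inj: "r = q" if "psum \<beta> r = psum \<beta> q" "r \<le> length \<beta>" "q \<le> length \<beta>" for r q
    by (rule inj_onD[OF inj_on_psum[OF assms(2)]]) (use that in simp_all)
  have "i 0 = 0" by (rule inj) (use i[of 0] in auto)
  moreover have "i (length \<alpha>) = length \<beta>"
    by (rule inj) (use i[of "length \<alpha>"] assms(1,2) in \<open>auto simp: compositions_def\<close>)
  moreover have "i j < i (Suc j) \<and> \<alpha> ! j = (\<Sum>r = i j..<i (Suc j). \<beta> ! r)"
    if "j < length \<alpha>" for j
  proof -
    have "psum \<alpha> j < psum \<alpha> (Suc j)" using psum_less_iff[OF assms(1), of j "Suc j"] that by auto
    then have lt: "i j < i (Suc j)"
      using i[of j] i[of "Suc j"] psum_less_iff[OF assms(2), of "i j" "i (Suc j)"] that by auto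
    have "psum \<beta> (i j) + (\<Sum>r = i j..<i (Suc j). \<beta> ! r) = psum \<beta> (i (Suc j))"
      using conjunct1[OF i, of j] conjunct1[OF i, of "Suc j"] that lt
        sum.atLeastLessThan_concat[of 0 "i j" "i (Suc j)" "(!) \<beta>"]
      by (simp add: psum_eq_sum)
    then show ?thesis using lt i[of j] i[of "Suc j"] psum_Suc[OF that] that by simp
  qed
  ultimately show ?thesis unfolding cut_indices_def by blast
qed

lemma sum_blocks:
  fixes i :: "nat \<Rightarrow> nat" and f :: "nat \<Rightarrow> 'b::comm_monoid_add"
  assumes "i 0 = 0" "\<And>j. j < k \<Longrightarrow> i j \<le> i (Suc j)"
  shows "(\<Sum>r<i k. f r) = (\<Sum>j<k. \<Sum>r = i j..<i (Suc j). f r)"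
  using assms(2)
proof (induction k)
  case (Suc k)
  then have "(\<Sum>r<i (Suc k). f r) = (\<Sum>r<i k. f r) + (\<Sum>r = i k..<i (Suc k). f r)"
    using sum.atLeastLessThan_concat[of 0 "i k" "i (Suc k)" f]
    by (simp add: lessThan_atLeast0)
  then show ?case using Suc by simp
qed (simp add: assms(1))

text \<open>Telescoping the block sums shows what any admissible \<open>i\<close> must satisfy, so
  the arbitrary choice in \<open>s_exp\<close> can be worked with. The bound descends from the known
  last value \<open>i (length \<alpha>)\<close>.\<close>

lemma cut_indices_psum:
  assumes "cut_indices \<alpha> \<beta> i" "j \<le> length \<alpha>"
  shows "i j \<le> length \<beta> \<and> psum \<beta> (i j) = psum \<alpha> j"
proof -
  have step: "i j < i (Suc j)" if "j < length \<alpha>" for j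
    using assms(1) that by (auto simp: cut_indices_def)
  have le: "i j \<le> length \<beta>" if "j \<le> length \<alpha>" for j
    using that
  proof (induction j rule: inc_induct)
    case base
    then show ?case using assms(1) by (simp add: cut_indices_def)
  next
    case (step j)
    then show ?case using \<open>j < length \<alpha> \<Longrightarrow> i j < i (Suc j)\<close> by simp
  qed
  have "psum \<beta> (i j) = psum \<alpha> j"
    using assms(2)
  proof (induction j)
    case 0
    then show ?case using assms(1) by (simp add: cut_indices_def)
  next
    case (Suc j)
    then have "psum \<beta> (i (Suc j)) = psum \<beta> (i j) + (\<Sum>r = i j..<i (Suc j). \<beta> ! r)"
      using le[of j] le[of "Suc j"] step[of j]
        sum.atLeastLessThan_concat[of 0 "i j" "i (Suc j)" "(!) \<beta>"]
      by (simp add: psum_eq_sum)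
    then show ?case using Suc assms(1) by (simp add: psum_Suc cut_indices_def)
  qed
  then show ?thesis using le assms(2) by simp
qed

text \<open>The parts of \<open>\<beta>\<close> merged into one part of \<open>\<alpha>\<close> form
  a block of indices. Partial sums strictly inside block \<open>j\<close> (counted from 0) are the
  elements of \<open>sub \<beta> - sub \<alpha>\<close> between two consecutive partial sums of
  \<open>\<alpha>\<close>, and each has weight \<open>Suc j\<close>.\<close>

lemma s_exp_eq:
  assumes \<alpha>: "\<alpha> \<in> compositions n" and \<beta>: "\<beta> \<in> compositions n" and le: "sub \<alpha> \<subseteq> sub \<beta>"
  shows "s_exp \<alpha> \<beta> = (\<Sum>d\<in>sub \<beta> - sub \<alpha>. Suc (card {a \<in> sub \<alpha>. a < d}))"
proof -
  define i where "i = (SOME i. cut_indices \<alpha> \<beta> i)"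
  have ci: "cut_indices \<alpha> \<beta> i"
    unfolding i_def using someI_ex[OF cut_indices_ex[OF assms]] .
  then have i0: "i 0 = 0" and ik: "i (length \<alpha>) = length \<beta>"
    and step: "\<And>j. j < length \<alpha> \<Longrightarrow> i j < i (Suc j)"
    by (auto simp: cut_indices_def)
  note i = cut_indices_psum[OF ci]
  let ?c = "\<lambda>d. Suc (card {a \<in> sub \<alpha>. a < d})"
  define R where "R = {r \<in> {..<length \<beta>}. 0 < r \<and> psum \<beta> r \<notin> sub \<alpha>}"
  \<comment> \<open>The value 0 at \<open>r = 0\<close> and at the cut points lets \<open>f\<close>
    be summed over whole blocks.\<close>
  define f where "f r = (if 0 < r \<and> psum \<beta> r \<notin> sub \<alpha> then ?c (psum \<beta> r) else 0)" for r
  have block: "(\<Sum>r = i j..<i (Suc j). f r) = Suc j * (i (Suc j) - i j - 1)"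
    if j: "j < length \<alpha>" for j
  proof -
    \<comment> \<open>A block begins at 0 or at a cut point; this vanishing term accounts for the
      \<open>- 1\<close> in the block's contribution.\<close>
    have "f (i j) = 0"
      using i[of j] i0 j by (cases "j = 0") (auto simp: f_def sub_eq_image)
    moreover have "f r = Suc j" if r: "i j < r" "r < i (Suc j)" for r
    proof -
      have rl: "r \<le> length \<beta>" using r i[of "Suc j"] j by simp
      have lt: "psum \<alpha> j < psum \<beta> r" "psum \<beta> r < psum \<alpha> (Suc j)"
        using r rl i[of j] i[of "Suc j"] j psum_less_iff[OF \<beta>, of "i j" r]
          psum_less_iff[OF \<beta>, of r "i (Suc j)"] by auto
      have "psum \<beta> r \<notin> sub \<alpha>"
      proof
        assume "psum \<beta> r \<in> sub \<alpha>"
        then obtain q where q: "q < length \<alpha>" "psum \<beta> r = psum \<alpha> q" by (auto simp: sub_eq_image)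
        then have "j < q" "q < Suc j"
          using lt j psum_less_iff[OF \<alpha>, of j q] psum_less_iff[OF \<alpha>, of q "Suc j"] by auto
        then show False by simp
      qed
      moreover have "?c (psum \<beta> r) = Suc j"
        by (rule card_sub_less[OF \<alpha>]) (use lt j in auto)
      ultimately show ?thesis using r by (simp add: f_def)
    qed
    ultimately have "(\<Sum>r = Suc (i j)..<i (Suc j). f r) = (\<Sum>r = Suc (i j)..<i (Suc j). Suc j)"
      "f (i j) = 0" by (auto intro!: sum.cong)
    then show ?thesis using step[OF j] by (simp add: sum.atLeast_Suc_lessThan mult.commute)
  qed
  have "s_exp \<alpha> \<beta> = (\<Sum>j = 1..length \<alpha>. j * (i j - i (j - 1) - 1))"
    unfolding s_exp_def Let_def i_def ..
  also have "\<dots> = (\<Sum>j<length \<alpha>. Suc j * (i (Suc j) - i j - 1))"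
    by (rule sum.reindex_bij_witness[of _ Suc "\<lambda>j. j - 1"]) auto
  also have "\<dots> = (\<Sum>r<length \<beta>. f r)"
    unfolding ik[symmetric] using block step i0
    by (subst sum_blocks[of i, OF i0]) (auto intro!: sum.cong less_imp_le)
  also have "\<dots> = (\<Sum>r\<in>R. ?c (psum \<beta> r))"
    unfolding R_def f_def by (rule sum.inter_filter[symmetric]) simp
  also have "\<dots> = (\<Sum>d\<in>psum \<beta> ` R. ?c d)"
    by (rule sum.reindex_cong[symmetric, OF _ refl refl])
      (auto simp: R_def intro: inj_on_subset[OF inj_on_psum[OF \<beta>]])
  also have "psum \<beta> ` R = sub \<beta> - sub \<alpha>"
    by (auto simp: R_def sub_eq_image)
  finally show ?thesis .
qed

section \<open>Adding the exponents, and cancellation over an interval of sets\<close>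

lemma g_exp_add_s_exp:
  assumes "\<gamma> \<in> compositions n" "\<beta> \<in> compositions n" "sub \<alpha> \<subseteq> sub \<gamma>" "sub \<gamma> \<subseteq> sub \<beta>"
  shows "g_exp \<alpha> \<gamma> + s_exp \<gamma> \<beta> = (\<Sum>d\<in>sub \<beta> - sub \<alpha>. Suc (card {c \<in> sub \<gamma>. c < d}))"
proof -
  \<comment> \<open>The composition \<open>\<gamma>\<close> is the second argument of
    \<open>g_exp\<close> and the first of \<open>s_exp\<close>, so both sums count elements of
    \<open>sub \<gamma>\<close> and differ only in their disjoint ranges.\<close>
  have "sub \<beta> - sub \<alpha> = (sub \<gamma> - sub \<alpha>) \<union> (sub \<beta> - sub \<gamma>)" using assms by blast
  then have "(\<Sum>d\<in>sub \<beta> - sub \<alpha>. f d) = (\<Sum>d\<in>sub \<gamma> - sub \<alpha>. f d) + (\<Sum>d\<in>sub \<beta> - sub \<gamma>. f d)"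
    for f :: "nat \<Rightarrow> nat"
    by (simp only:) (rule sum.union_disjoint, auto simp: finite_sub)
  then show ?thesis
    by (simp only: g_exp_eq[OF assms(1)] s_exp_eq[OF assms(1,2,4)])
qed

text \<open>Set form of an entry of the product of the two transition matrices. Toggling the
  membership of \<open>m = Max (B - A)\<close> in \<open>C\<close> pairs the terms: the exponent
  stays fixed while the sign flips.\<close>

lemma sum_interval_sign:
  fixes A B :: "nat set" and t :: "'a::comm_ring_1"
  assumes "finite B" "A \<subseteq> B"
  shows "(\<Sum>C | A \<subseteq> C \<and> C \<subseteq> B.
      (-1) ^ card (B - C) * t ^ (\<Sum>d\<in>B - A. Suc (card {c \<in> C. c < d}))) = (if A = B then 1 else 0)"
    (is "sum ?f _ = _")
proof (cases "A = B")
  case True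
  then have "{C. A \<subseteq> C \<and> C \<subseteq> B} = {B}" by blast
  then show ?thesis using True by simp
next
  case False
  define m where "m = Max (B - A)"
  have m: "m \<in> B - A"
    unfolding m_def by (rule Max_in) (use False assms in auto)
  have max: "d \<le> m" if "d \<in> B - A" for d
    unfolding m_def by (rule Max_ge) (use that assms in auto)
  let ?D = "{C. A \<subseteq> C \<and> C \<subseteq> B - {m}}"
  have fin: "finite ?D" using assms by (auto intro: finite_subset[of _ "Pow B"])
  have "{C. A \<subseteq> C \<and> C \<subseteq> B} = ?D \<union> insert m ` ?D"
  proof (intro equalityI subsetI)
    fix C assume C: "C \<in> {C. A \<subseteq> C \<and> C \<subseteq> B}"
    show "C \<in> ?D \<union> insert m ` ?D"
    proof (cases "m \<in> C")
      case True
      then have "C = insert m (C - {m})" "C - {m} \<in> ?D" using C m by auto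
      then show ?thesis by blast
    qed (use C in auto)
  qed (use m in auto)
  moreover have "?D \<inter> insert m ` ?D = {}" by auto
  moreover have "inj_on (insert m) ?D" by (intro inj_onI) (auto simp: insert_eq_iff)
  ultimately have "sum ?f {C. A \<subseteq> C \<and> C \<subseteq> B} = (\<Sum>C\<in>?D. ?f C + ?f (insert m C))"
    using fin by (simp add: sum.union_disjoint sum.reindex sum.distrib)
  also have "\<dots> = 0"
  proof (rule sum.neutral, rule ballI)
    fix C assume C: "C \<in> ?D"
    \<comment> \<open>Maximality of \<open>m\<close> excludes \<open>m < d\<close>, so inserting
      \<open>m\<close> changes none of the counts.\<close>
    have "{c \<in> insert m C. c < d} = {c \<in> C. c < d}" if "d \<in> B - A" for d
      using max[OF that] by auto
    then have e: "(\<Sum>d\<in>B - A. Suc (card {c \<in> insert m C. c < d}))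
        = (\<Sum>d\<in>B - A. Suc (card {c \<in> C. c < d}))" by simp
    have "B - C = insert m (B - insert m C)" using C m by auto
    then have "card (B - C) = Suc (card (B - insert m C))"
      using assms by (metis Diff_iff card_insert_disjoint finite_Diff insertCI)
    then show "?f C + ?f (insert m C) = 0" by (simp only: e) simp
  qed
  finally show ?thesis using False by simp
qed

section \<open>Coefficients of monomials\<close>

abbreviation lookup :: "('b \<Rightarrow>\<^sub>0 'c::zero) \<Rightarrow> 'b \<Rightarrow> 'c" where
  "lookup \<equiv> Poly_Mapping.lookup"

text \<open>Exponent vector of the monomial belonging to the word \<open>w\<close>.\<close>

definition content :: "nat list \<Rightarrow> nat \<Rightarrow>\<^sub>0 nat" where
  "content w = (\<Sum>i\<leftarrow>w. Poly_Mapping.single i 1)"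

lemma lookup_content: "lookup (content w) i = count_list w i"
  by (induction w) (auto simp: content_def lookup_add lookup_single)

text \<open>A sorted word is determined by its letter multiplicities. Hence no monomial arises twice
  in \<open>F\<close>, and its coefficients there are 0 or 1.\<close>

lemma content_eq_imp_eq:
  assumes "sorted v" "sorted w" "content v = content w"
  shows "v = w"
proof -
  have "mset v = mset w"
    by (rule multiset_eqI) (metis assms(3) count_mset lookup_content)
  then show ?thesis using assms by (metis properties_for_sort)
qed

lemma prod_list_map_var: "prod_list (map var w) = Poly_Mapping.single (content w) 1"
  by (induction w) (simp_all add: content_def var_def mult_single)

lemma lookup_scale: "lookup (scale c p) m = c * lookup p m"
proof -
  have "scale c p = Poly_Mapping.map ((*) c) p"
    by (simp add: scale_def mult_map_scale_conv_mult)
  then show ?thesis by (simp add: map.rep_eq when_def)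
qed

lemma finite_words: "finite (words N \<alpha>)"
  by (rule finite_subset[OF _ finite_lists_length_eq[of "{1..N}" "sum_list \<alpha>"]])
    (auto simp: words_def)

lemma lookup_F:
  assumes "sorted v"
  shows "lookup (F N \<alpha> :: 'a::comm_ring_1 polynomials) (content v) = (if v \<in> words N \<alpha> then 1 else 0)"
proof -
  have "lookup (F N \<alpha> :: 'a polynomials) (content v) = (\<Sum>w\<in>words N \<alpha>. if w = v then 1 else 0)"
    unfolding F_def prod_list_map_var lookup_sum
    by (rule sum.cong) (auto simp: lookup_single words_def when_def
        dest: content_eq_imp_eq[OF _ assms])
  then show ?thesis using finite_words by simp
qed

text \<open>For \<open>C \<subseteq> {1..<n}\<close> with \<open>n > 0\<close> this word starts with
  1 and rises by one exactly on entering a 0-based position in \<open>C\<close>, so its set of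
  ascents is \<open>C\<close>.\<close>

definition ascent_word :: "nat \<Rightarrow> nat set \<Rightarrow> nat list" where
  "ascent_word n C = map (\<lambda>j. Suc (card {c \<in> C. c \<le> j})) [0..<n]"

lemma sorted_ascent_word: "finite C \<Longrightarrow> sorted (ascent_word n C)"
  by (auto simp: ascent_word_def sorted_iff_nth_mono intro!: card_mono)

lemma ascent_word_in_words_iff:
  assumes "\<beta> \<in> compositions n" "C \<subseteq> {1..<n}" "n \<le> N"
  shows "ascent_word n C \<in> words N \<beta> \<longleftrightarrow> sub \<beta> \<subseteq> C"
proof -
  have fin: "finite C" using assms(2) finite_subset by blast
  \<comment> \<open>There are at most \<open>n - 1\<close> ascents, so \<open>N \<ge> n\<close>
    letters suffice.\<close>
  have "card {c \<in> C. c \<le> j} < N" if "j < n" for j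
  proof -
    have "card {c \<in> C. c \<le> j} \<le> card {1..<n}" using assms(2) by (intro card_mono) auto
    then show ?thesis using that assms(3) by simp
  qed
  then have "set (ascent_word n C) \<subseteq> {1..N}"
    by (auto simp: ascent_word_def Suc_le_eq)
  moreover have "ascent_word n C ! (j - 1) < ascent_word n C ! j \<longleftrightarrow> j \<in> C" if "j \<in> sub \<beta>" for j
  proof -
    have j: "1 \<le> j" "j < n" using sub_subset[OF assms(1)] that by auto
    \<comment> \<open>Passing from position \<open>j - 1\<close> to \<open>j\<close> can add only
      the element \<open>j\<close> to the count.\<close>
    have "{c \<in> C. c \<le> j} = (if j \<in> C then insert j {c \<in> C. c \<le> j - 1} else {c \<in> C. c \<le> j - 1})"
      using j by (auto simp: le_less)
    then have "card {c \<in> C. c \<le> j}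
        = (if j \<in> C then Suc (card {c \<in> C. c \<le> j - 1}) else card {c \<in> C. c \<le> j - 1})"
      using j fin by simp
    then show ?thesis using j by (simp add: ascent_word_def)
  qed
  moreover have "sum_list \<beta> = n" using assms(1) by (simp add: compositions_def)
  ultimately show ?thesis
    using sorted_ascent_word[OF fin] by (auto simp: words_def ascent_word_def)
qed

section \<open>The expansion\<close>

lemma lookup_F_ascent_word:
  assumes "\<beta> \<in> compositions n" "\<gamma> \<in> compositions n" "n \<le> N"
  shows "lookup (F N \<beta> :: 'a::comm_ring_1 polynomials) (content (ascent_word n (sub \<gamma>)))
    = (if sub \<beta> \<subseteq> sub \<gamma> then 1 else 0)"
  using ascent_word_in_words_iff[OF assms(1) sub_subset[OF assms(2)] assms(3)]
  by (simp add: lookup_F sorted_ascent_word finite_sub)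

lemma G_eq:
  assumes "\<alpha> \<in> compositions n"
  shows "G t N \<alpha> = (\<Sum>\<beta> | \<beta> \<in> compositions n \<and> sub \<alpha> \<subseteq> sub \<beta>.
     scale ((-1) ^ card (sub \<beta> - sub \<alpha>) * t ^ s_exp \<alpha> \<beta>) (F N \<beta>))"
proof -
  have "sum_list \<alpha> = n" using assms by (simp add: compositions_def)
  then show ?thesis
    unfolding G_def finer_def using assms by (auto intro!: sum.cong simp: length_diff_eq_card)
qed

text \<open>Only those \<open>\<delta>\<close> contribute for which \<open>sub \<delta>\<close> lies
  between \<open>sub \<beta>\<close> and \<open>sub \<gamma>\<close>. There are none if
  \<open>sub \<beta>\<close> is not contained in \<open>sub \<gamma>\<close>, and only
  \<open>\<beta>\<close> itself, with coefficient 1, if the two sets agree.\<close>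

lemma lookup_G_ascent_word:
  fixes t :: "'a::comm_ring_1"
  assumes "\<beta> \<in> compositions n" "\<gamma> \<in> compositions n" "n \<le> N"
  shows "sub \<gamma> = sub \<beta> \<Longrightarrow> lookup (G t N \<beta>) (content (ascent_word n (sub \<gamma>))) = 1"
    and "\<not> sub \<beta> \<subseteq> sub \<gamma> \<Longrightarrow> lookup (G t N \<beta>) (content (ascent_word n (sub \<gamma>))) = 0"
proof -
  let ?I = "{\<delta>. \<delta> \<in> compositions n \<and> sub \<beta> \<subseteq> sub \<delta>}"
  have fin: "finite ?I" using finite_compositions by simp
  have eq: "lookup (G t N \<beta>) (content (ascent_word n (sub \<gamma>)))
    = (\<Sum>\<delta>\<in>?I. if sub \<delta> \<subseteq> sub \<gamma> then (-1) ^ card (sub \<delta> - sub \<beta>) * t ^ s_exp \<beta> \<delta> else 0)"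
    unfolding G_eq[OF assms(1)] lookup_sum lookup_scale
    by (rule sum.cong) (auto simp: lookup_F_ascent_word assms)
  show "lookup (G t N \<beta>) (content (ascent_word n (sub \<gamma>))) = 0" if "\<not> sub \<beta> \<subseteq> sub \<gamma>"
    unfolding eq by (rule sum.neutral) (use that in auto)
  show "lookup (G t N \<beta>) (content (ascent_word n (sub \<gamma>))) = 1" if "sub \<gamma> = sub \<beta>"
  proof -
    have "sub \<delta> \<subseteq> sub \<gamma> \<longleftrightarrow> \<delta> = \<beta>" if "\<delta> \<in> ?I" for \<delta>
      using that \<open>sub \<gamma> = sub \<beta>\<close> assms inj_onD[OF inj_on_sub, of \<delta> \<beta> n] by auto
    then have "lookup (G t N \<beta>) (content (ascent_word n (sub \<gamma>)))
      = (\<Sum>\<delta>\<in>?I. if \<delta> = \<beta> then (-1) ^ card (sub \<delta> - sub \<beta>) * t ^ s_exp \<beta> \<delta> else 0)"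
      unfolding eq by (intro sum.cong) auto
    also have "\<dots> = t ^ s_exp \<beta> \<beta>" using fin assms by simp
    also have "\<dots> = 1" using s_exp_eq[OF assms(1,1)] by simp
    finally show ?thesis .
  qed
qed

section \<open>Linear independence\<close>

text \<open>Unitriangularity with respect to inclusion, by induction on
  \<open>card (sub \<gamma>)\<close>. In the coefficient at the ascent word of
  \<open>\<gamma>\<close>, properly smaller sets drop out by induction and sets not contained in
  \<open>sub \<gamma>\<close> by triangularity. The diagonal entry 1 makes this work over any
  coefficient ring.\<close>

lemma G_lincomb_zero:
  fixes t :: "'a::comm_ring_1"
  assumes "n \<le> N" and zero: "(\<Sum>\<beta>\<in>compositions n. scale (c \<beta>) (G t N \<beta>)) = 0"
    and "\<gamma> \<in> compositions n"
  shows "c \<gamma> = 0"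
  using assms(3)
proof (induction "card (sub \<gamma>)" arbitrary: \<gamma> rule: less_induct)
  case less
  let ?l = "\<lambda>\<beta>. lookup (G t N \<beta>) (content (ascent_word n (sub \<gamma>)))"
  have "c \<beta> * ?l \<beta> = (if \<beta> = \<gamma> then c \<gamma> else 0)" if \<beta>: "\<beta> \<in> compositions n" for \<beta>
  proof -
    consider "sub \<beta> \<subset> sub \<gamma>" | "\<not> sub \<beta> \<subseteq> sub \<gamma>" | "\<beta> = \<gamma>"
      using inj_onD[OF inj_on_sub, of \<beta> \<gamma> n] \<beta> less.prems by blast
    then show ?thesis
    proof cases
      case 1
      then show ?thesis using less.hyps[OF psubset_card_mono[OF finite_sub 1] \<beta>] by auto
    next
      case 2
      then show ?thesis using lookup_G_ascent_word(2)[OF \<beta> less.prems assms(1) 2, of t] by auto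
    next
      case 3
      then show ?thesis
        using lookup_G_ascent_word(1)[OF less.prems less.prems assms(1) refl, of t] by simp
    qed
  qed
  then have "lookup (\<Sum>\<beta>\<in>compositions n. scale (c \<beta>) (G t N \<beta>)) (content (ascent_word n (sub \<gamma>)))
      = (\<Sum>\<beta>\<in>compositions n. if \<beta> = \<gamma> then c \<gamma> else 0)"
    unfolding lookup_sum lookup_scale by (intro sum.cong) auto
  then show ?case using zero less.prems finite_compositions by simp
qed

text \<open>Independence of a set of polynomials cannot detect repetitions in the family, so
  distinctness is derived from the indexed statement: two equal members give a vanishing combination
  with coefficients 1 and -1.\<close>

lemma inj_on_G:
  fixes t :: "'a::comm_ring_1"
  assumes "n \<le> N"
  shows "inj_on (G t N) (compositions n)"
proof (rule inj_onI, rule ccontr)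
  fix \<alpha> \<beta> assume \<alpha>: "\<alpha> \<in> compositions n" and \<beta>: "\<beta> \<in> compositions n"
    and eq: "G t N \<alpha> = G t N \<beta>" and ne: "\<alpha> \<noteq> \<beta>"
  have "(\<Sum>\<gamma>\<in>compositions n. scale (of_bool (\<gamma> = \<alpha>) - of_bool (\<gamma> = \<beta>)) (G t N \<gamma>))
      = (\<Sum>\<gamma>\<in>compositions n. (if \<gamma> = \<alpha> then G t N \<gamma> else 0) - (if \<gamma> = \<beta> then G t N \<gamma> else 0))"
    using ne by (intro sum.cong) auto
  also have "\<dots> = 0"
    using \<alpha> \<beta> eq finite_compositions by (simp add: sum_subtractf)
  finally have "of_bool (\<alpha> = \<alpha>) - of_bool (\<alpha> = \<beta>) = (0::'a)"
    using \<alpha> by (rule G_lincomb_zero[OF assms])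
  then show False using ne by simp
qed

lemma independent_G:
  fixes t :: "'a::comm_ring_1"
  assumes "n \<le> N"
  shows "polys.independent (G t N ` compositions n)"
proof -
  have "u (G t N \<beta>) = 0"
    if "(\<Sum>x\<in>G t N ` compositions n. scale (u x) x) = 0" "\<beta> \<in> compositions n" for u \<beta>
    using G_lincomb_zero[OF assms, of "\<lambda>\<beta>. u (G t N \<beta>)" t \<beta>] that
    by (simp add: sum.reindex[OF inj_on_G[OF assms]])
  then show ?thesis
    by (auto simp: polys.dependent_finite finite_compositions)
qed

text \<open>After expanding each \<open>G t N \<gamma>\<close> and exchanging the sums, the
  coefficient of \<open>F N \<beta>\<close> is an alternating sum over the sets between
  \<open>sub \<alpha>\<close> and \<open>sub \<beta>\<close>, which is a Kronecker delta.\<close>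

lemma F_eq_sum_G:
  fixes t :: "'a::comm_ring_1"
  assumes \<alpha>: "\<alpha> \<in> compositions n"
  shows "F N \<alpha> = (\<Sum>\<gamma> | \<gamma> \<in> compositions n \<and> sub \<alpha> \<subseteq> sub \<gamma>. scale (t ^ g_exp \<alpha> \<gamma>) (G t N \<gamma>))"
proof -
  let ?K = "compositions n"
  let ?e = "\<lambda>B C. \<Sum>d\<in>B - sub \<alpha>. Suc (card {c \<in> C. c < d})"
  have inner: "(\<Sum>\<gamma> | \<gamma> \<in> ?K \<and> sub \<alpha> \<subseteq> sub \<gamma> \<and> sub \<gamma> \<subseteq> sub \<beta>.
      t ^ g_exp \<alpha> \<gamma> * ((-1) ^ card (sub \<beta> - sub \<gamma>) * t ^ s_exp \<gamma> \<beta>)) = (if \<beta> = \<alpha> then 1 else 0)"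
    (is "?lhs = _") if \<beta>: "\<beta> \<in> ?K" and le: "sub \<alpha> \<subseteq> sub \<beta>" for \<beta>
  proof -
    have "?lhs = (\<Sum>\<gamma> | \<gamma> \<in> ?K \<and> sub \<alpha> \<subseteq> sub \<gamma> \<and> sub \<gamma> \<subseteq> sub \<beta>.
        (-1) ^ card (sub \<beta> - sub \<gamma>) * t ^ ?e (sub \<beta>) (sub \<gamma>))"
    proof (intro sum.cong refl)
      fix \<gamma> assume "\<gamma> \<in> {\<gamma> \<in> ?K. sub \<alpha> \<subseteq> sub \<gamma> \<and> sub \<gamma> \<subseteq> sub \<beta>}"
      then have e: "?e (sub \<beta>) (sub \<gamma>) = g_exp \<alpha> \<gamma> + s_exp \<gamma> \<beta>"
        using g_exp_add_s_exp[of \<gamma> n \<beta> \<alpha>] \<beta> by simp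
      show "t ^ g_exp \<alpha> \<gamma> * ((-1) ^ card (sub \<beta> - sub \<gamma>) * t ^ s_exp \<gamma> \<beta>)
          = (-1) ^ card (sub \<beta> - sub \<gamma>) * t ^ ?e (sub \<beta>) (sub \<gamma>)"
        unfolding e power_add by (rule mult.left_commute)
    qed
    also have "\<dots> = (\<Sum>C | sub \<alpha> \<subseteq> C \<and> C \<subseteq> sub \<beta>. (-1) ^ card (sub \<beta> - C) * t ^ ?e (sub \<beta>) C)"
    proof (rule sum.reindex_bij_betw)
      have "sub ` {\<gamma> \<in> ?K. sub \<alpha> \<subseteq> sub \<gamma> \<and> sub \<gamma> \<subseteq> sub \<beta>} = {C. sub \<alpha> \<subseteq> C \<and> C \<subseteq> sub \<beta>}"
      proof (intro equalityI subsetI)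
        fix C assume C: "C \<in> {C. sub \<alpha> \<subseteq> C \<and> C \<subseteq> sub \<beta>}"
        then have "C \<in> sub ` ?K"
          using sub_subset[OF \<beta>] by (intro Pow_subset_image_sub) auto
        then show "C \<in> sub ` {\<gamma> \<in> ?K. sub \<alpha> \<subseteq> sub \<gamma> \<and> sub \<gamma> \<subseteq> sub \<beta>}"
          using C by auto
      qed auto
      then show "bij_betw sub {\<gamma> \<in> ?K. sub \<alpha> \<subseteq> sub \<gamma> \<and> sub \<gamma> \<subseteq> sub \<beta>} {C. sub \<alpha> \<subseteq> C \<and> C \<subseteq> sub \<beta>}"
        by (auto simp: bij_betw_def intro: inj_on_subset[OF inj_on_sub])
    qed
    also have "\<dots> = (if sub \<alpha> = sub \<beta> then 1 else 0)"
      by (rule sum_interval_sign[OF finite_sub le])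
    finally show ?thesis using inj_onD[OF inj_on_sub, of \<alpha> \<beta> n] \<alpha> \<beta> by auto
  qed
  let ?h = "\<lambda>\<gamma> \<beta>. scale (t ^ g_exp \<alpha> \<gamma> * ((-1) ^ card (sub \<beta> - sub \<gamma>) * t ^ s_exp \<gamma> \<beta>)) (F N \<beta>)"
  have "(\<Sum>\<gamma> | \<gamma> \<in> ?K \<and> sub \<alpha> \<subseteq> sub \<gamma>. scale (t ^ g_exp \<alpha> \<gamma>) (G t N \<gamma>))
      = (\<Sum>\<gamma> | \<gamma> \<in> ?K \<and> sub \<alpha> \<subseteq> sub \<gamma>. \<Sum>\<beta> | \<beta> \<in> ?K \<and> sub \<gamma> \<subseteq> sub \<beta>. ?h \<gamma> \<beta>)"
    by (rule sum.cong) (auto simp: G_eq polys.scale_sum_right)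
  \<comment> \<open>The added condition on \<open>\<beta>\<close> follows by transitivity; it gives
    the inner sum a range independent of \<open>\<gamma>\<close> apart from the relation, as the
    exchange requires.\<close>
  also have "\<dots> = (\<Sum>\<gamma> | \<gamma> \<in> ?K \<and> sub \<alpha> \<subseteq> sub \<gamma>.
      \<Sum>\<beta> | \<beta> \<in> {\<beta> \<in> ?K. sub \<alpha> \<subseteq> sub \<beta>} \<and> sub \<gamma> \<subseteq> sub \<beta>. ?h \<gamma> \<beta>)"
    by (intro sum.cong) auto
  also have "\<dots> = (\<Sum>\<beta> | \<beta> \<in> ?K \<and> sub \<alpha> \<subseteq> sub \<beta>.
      \<Sum>\<gamma> | \<gamma> \<in> {\<gamma> \<in> ?K. sub \<alpha> \<subseteq> sub \<gamma>} \<and> sub \<gamma> \<subseteq> sub \<beta>. ?h \<gamma> \<beta>)"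
    by (rule sum.swap_restrict) (auto simp: finite_compositions)
  also have "\<dots> = (\<Sum>\<beta> | \<beta> \<in> ?K \<and> sub \<alpha> \<subseteq> sub \<beta>. scale (if \<beta> = \<alpha> then 1 else 0) (F N \<beta>))"
    by (intro sum.cong refl) (auto simp: polys.scale_sum_left[symmetric] inner)
  also have "\<dots> = (\<Sum>\<beta> | \<beta> \<in> ?K \<and> sub \<alpha> \<subseteq> sub \<beta>. if \<beta> = \<alpha> then F N \<beta> else 0)"
    by (rule sum.cong) auto
  also have "\<dots> = F N \<alpha>" using \<alpha> finite_compositions by simp
  finally show ?thesis by simp
qed

section \<open>Reading off coefficients\<close>

lemma (in module) representation_image:
  assumes indep: "independent (v ` I)" and inj: "inj_on v I" and fin: "finite I" and "i \<in> I"
  shows "representation (v ` I) (\<Sum>j\<in>I. c j *s v j) (v i) = c i"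
proof -
  \<comment> \<open>\<open>representation\<close> takes coefficients attached to vectors;
    \<open>?f\<close> moves those attached to indices along the inverse of \<open>v\<close>, with 0
    off the image.\<close>
  let ?f = "\<lambda>x. if x \<in> v ` I then c (the_inv_into I v x) else 0"
  have f: "?f (v j) = c j" if "j \<in> I" for j
    using that inj by (simp add: the_inv_into_f_f)
  have "representation (v ` I) (\<Sum>j\<in>I. c j *s v j) = ?f"
  proof (rule representation_eqI[OF indep])
    show "(\<Sum>j\<in>I. c j *s v j) \<in> span (v ` I)"
      by (intro span_sum span_scale span_base) auto
    show "b \<in> v ` I" if "?f b \<noteq> 0" for b using that by presburger
    then have sub: "{b. ?f b \<noteq> 0} \<subseteq> v ` I" by blast
    then show "finite {b. ?f b \<noteq> 0}" using fin finite_subset by blast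
    have "(\<Sum>b | ?f b \<noteq> 0. ?f b *s b) = (\<Sum>b\<in>v ` I. ?f b *s b)"
      by (rule sum.mono_neutral_left) (use fin sub in auto)
    also have "\<dots> = (\<Sum>j\<in>I. c j *s v j)"
      unfolding sum.reindex[OF inj] by (intro sum.cong refl) (simp only: comp_apply f)
    finally show "(\<Sum>b | ?f b \<noteq> 0. ?f b *s b) = (\<Sum>j\<in>I. c j *s v j)" .
  qed
  then show ?thesis using f \<open>i \<in> I\<close> by metis
qed

theorem theorem5p1:
  fixes t :: "'a::comm_ring_1" and n N :: nat and \<alpha> :: "nat list"
  assumes "\<alpha> \<in> compositions n" and "n \<le> N"
  shows "inj_on (G t N) (compositions n) \<and>
    polys.independent (G t N ` compositions n) \<and>
    (\<forall>\<beta>\<in>compositions n.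
       polys.representation (G t N ` compositions n) (F N \<alpha>) (G t N \<beta>) =
         (if finer \<beta> \<alpha> then t ^ g_exp \<alpha> \<beta> else 0)) \<and>
    F N \<alpha> = (\<Sum>\<beta> | \<beta> \<in> compositions n \<and> finer \<beta> \<alpha>. scale (t ^ g_exp \<alpha> \<beta>) (G t N \<beta>))"
proof -
  let ?c = "\<lambda>\<beta>. if finer \<beta> \<alpha> then t ^ g_exp \<alpha> \<beta> else 0"
  have F: "F N \<alpha> = (\<Sum>\<beta> | \<beta> \<in> compositions n \<and> finer \<beta> \<alpha>. scale (t ^ g_exp \<alpha> \<beta>) (G t N \<beta>))"
    unfolding finer_def by (rule F_eq_sum_G[OF assms(1)])
  \<comment> \<open>Zero coefficients extend the sum to the whole family, so that coefficients can
    be compared for every \<open>\<beta>\<close>.\<close>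
  also have "\<dots> = (\<Sum>\<beta>\<in>compositions n. scale (?c \<beta>) (G t N \<beta>))"
    by (rule sum.mono_neutral_cong_left) (auto simp: finite_compositions)
  finally have "polys.representation (G t N ` compositions n) (F N \<alpha>) (G t N \<beta>) = ?c \<beta>"
    if "\<beta> \<in> compositions n" for \<beta>
    using polys.representation_image[OF independent_G inj_on_G finite_compositions that,
        OF assms(2,2), of t ?c] by simp
  then show ?thesis
    using inj_on_G[OF assms(2)] independent_G[OF assms(2)] F by blast
qed

end
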